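(* For every even integer $n\ge 4$, the $n$-prism $\Pi_n$ is edge-reflexive.
   Context: All graphs are finite. The $n$-prism $\Pi_n$ is the cubic graph of order $2n$ obtained as the Cartesian product of an $n$-cycle and $K_2$. A 3-coloring of a graph $X$ is an unordered partition $\{V_1,V_2,V_3\}$ of $V(X)$ into three independent sets (a part may be empty); the $V_i$ are the color classes of the coloring. For a 3-colorable graph $X$, the 3-coloring complex $B(X)$ is the graph whose vertices are all color classes of all 3-colorings of $X$, with two vertices $C\neq D$ joined by an edge if $C$ and $D$ are color classes of a common 3-coloring of $X$. If $X$ is a 3-colorable graph without isolated vertices, then $B(X)$ is 3-colorable and the canonical map $\phi_X(v)=\{C\in V(B(X)) : v\in C\}$, $v\in V(X)$, is a graph homomorphism $X\to B(B(X))$. The graph $X$ is reflexive if $\phi_X$ is an isomorphism. A graph $G$ is 3-edge-colorable if its line graph $L(G)$ is 3-colorable, and edge-reflexive if it is 3-edge-colorable and $L(G)$ is reflexive. *)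

theory Defs
  imports Main
begin

record 'a ugraph =
  verts :: "'a set"
  edges :: "'a set set"

definition fin_simple_graph :: "'a ugraph \<Rightarrow> bool" where
  "fin_simple_graph G \<longleftrightarrow> finite (verts G) \<and> (\<forall>e\<in>edges G. e \<subseteq> verts G \<and> card e = 2)"

definition adj :: "'a ugraph \<Rightarrow> 'a \<Rightarrow> 'a \<Rightarrow> bool" where
  "adj G u v \<longleftrightarrow> {u, v} \<in> edges G"

definition no_isolated :: "'a ugraph \<Rightarrow> bool" where
  "no_isolated G \<longleftrightarrow> (\<forall>u\<in>verts G. \<exists>v\<in>verts G. adj G u v)"

definition graph_iso :: "('a \<Rightarrow> 'b) \<Rightarrow> 'a ugraph \<Rightarrow> 'b ugraph \<Rightarrow> bool" where
  "graph_iso f G H \<longleftrightarrow> bij_betw f (verts G) (verts H) \<and>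
     (\<forall>u\<in>verts G. \<forall>v\<in>verts G. adj G u v \<longleftrightarrow> adj H (f u) (f v))"

definition independent :: "'a ugraph \<Rightarrow> 'a set \<Rightarrow> bool" where
  "independent G S \<longleftrightarrow> S \<subseteq> verts G \<and> (\<forall>u\<in>S. \<forall>v\<in>S. \<not> adj G u v)"

text \<open>
  A 3-coloring is an unordered partition into three independent sets, where parts may be
  empty; hence it is represented by the set of its classes, and that set has fewer than three
  elements exactly when at least two of the parts are empty.
\<close>

definition three_coloring :: "'a ugraph \<Rightarrow> 'a set set \<Rightarrow> bool" where
  "three_coloring X P \<longleftrightarrow> (\<exists>V1 V2 V3. P = {V1, V2, V3} \<and>
     V1 \<union> V2 \<union> V3 = verts X \<and>
     V1 \<inter> V2 = {} \<and> V1 \<inter> V3 = {} \<and> V2 \<inter> V3 = {} \<and>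
     independent X V1 \<and> independent X V2 \<and> independent X V3)"

definition three_colorable :: "'a ugraph \<Rightarrow> bool" where
  "three_colorable X \<longleftrightarrow> (\<exists>P. three_coloring X P)"

definition coloring_complex :: "'a ugraph \<Rightarrow> 'a set ugraph" where
  "coloring_complex X =
     \<lparr> verts = {C. \<exists>P. three_coloring X P \<and> C \<in> P},
       edges = {{C, D} | C D. C \<noteq> D \<and> (\<exists>P. three_coloring X P \<and> C \<in> P \<and> D \<in> P)} \<rparr>"

definition canonical_map :: "'a ugraph \<Rightarrow> 'a \<Rightarrow> 'a set set" where
  "canonical_map X v = {C \<in> verts (coloring_complex X). v \<in> C}"

text \<open>
  Reflexivity only makes sense for 3-colorable graphs without isolated vertices, the graphs
  for which the canonical map is a homomorphism into the double coloring complex; both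
  conditions are therefore part of the definition.
\<close>

definition reflexive_graph :: "'a ugraph \<Rightarrow> bool" where
  "reflexive_graph X \<longleftrightarrow> three_colorable X \<and> no_isolated X \<and>
     graph_iso (canonical_map X) X (coloring_complex (coloring_complex X))"

definition line_graph :: "'a ugraph \<Rightarrow> 'a set ugraph" where
  "line_graph G =
     \<lparr> verts = edges G,
       edges = {{e, f} | e f. e \<in> edges G \<and> f \<in> edges G \<and> e \<noteq> f \<and> e \<inter> f \<noteq> {}} \<rparr>"

definition three_edge_colorable :: "'a ugraph \<Rightarrow> bool" where
  "three_edge_colorable G \<longleftrightarrow> three_colorable (line_graph G)"

definition edge_reflexive :: "'a ugraph \<Rightarrow> bool" where
  "edge_reflexive G \<longleftrightarrow> three_edge_colorable G \<and> reflexive_graph (line_graph G)"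

text \<open>The definition below is the usual cycle only for \<open>n \<ge> 3\<close>.\<close>

definition cycle_graph :: "nat \<Rightarrow> nat ugraph" where
  "cycle_graph n = \<lparr> verts = {..<n}, edges = {{i, (i + 1) mod n} | i. i < n} \<rparr>"

definition complete_graph :: "nat \<Rightarrow> nat ugraph" where
  "complete_graph n = \<lparr> verts = {..<n}, edges = {{i, j} | i j. i < n \<and> j < n \<and> i \<noteq> j} \<rparr>"

definition cartesian_product :: "'a ugraph \<Rightarrow> 'b ugraph \<Rightarrow> ('a \<times> 'b) ugraph" where
  "cartesian_product G H =
     \<lparr> verts = verts G \<times> verts H,
       edges = {{(a, b), (a', b')} | a b a' b'.
          a \<in> verts G \<and> a' \<in> verts G \<and> b \<in> verts H \<and> b' \<in> verts H \<and>
          (a = a' \<and> adj H b b' \<or> b = b' \<and> adj G a a')} \<rparr>"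

definition prism :: "nat \<Rightarrow> (nat \<times> nat) ugraph" where
  "prism n = cartesian_product (cycle_graph n) (complete_graph 2)"

lemma fin_simple_cycle_graph:
  assumes "n \<ge> 3"
  shows "fin_simple_graph (cycle_graph n)"
proof -
  have "i \<noteq> (i + 1) mod n" if "i < n" for i
    using that assms by (cases "i + 1 = n") auto
  then show ?thesis
    using assms by (auto simp: fin_simple_graph_def cycle_graph_def card_2_iff)
qed

lemma fin_simple_complete_graph: "fin_simple_graph (complete_graph n)"
  by (auto simp: fin_simple_graph_def complete_graph_def)

lemma fin_simple_cartesian_product:
  assumes "fin_simple_graph G" "fin_simple_graph H"
  shows "fin_simple_graph (cartesian_product G H)"
proof -
  have "a \<noteq> a'" if "adj G a a'" for a a'
    using that assms(1) by (auto simp: fin_simple_graph_def adj_def)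
  moreover have "b \<noteq> b'" if "adj H b b'" for b b'
    using that assms(2) by (auto simp: fin_simple_graph_def adj_def)
  ultimately show ?thesis
    using assms by (auto simp: fin_simple_graph_def cartesian_product_def card_insert_if)
qed

lemma fin_simple_prism: "n \<ge> 3 \<Longrightarrow> fin_simple_graph (prism n)"
  unfolding prism_def
  by (intro fin_simple_cartesian_product fin_simple_cycle_graph fin_simple_complete_graph)

lemma fin_simple_line_graph:
  assumes "fin_simple_graph G"
  shows "fin_simple_graph (line_graph G)"
proof -
  have "edges G \<subseteq> Pow (verts G)" "finite (Pow (verts G))"
    using assms by (auto simp: fin_simple_graph_def)
  then have "finite (edges G)" by (rule finite_subset)
  moreover have "card e = 2" if "e \<in> edges (line_graph G)" for e
    using that by (auto simp only: line_graph_def ugraph.simps mem_Collect_eq card_2_iff)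
  ultimately show ?thesis by (auto simp: fin_simple_graph_def line_graph_def)
qed

lemma fin_simple_coloring_complex:
  assumes "fin_simple_graph X"
  shows "fin_simple_graph (coloring_complex X)"
proof -
  have "verts (coloring_complex X) \<subseteq> Pow (verts X)"
    by (auto simp: coloring_complex_def three_coloring_def)
  moreover have "finite (Pow (verts X))"
    using assms by (auto simp: fin_simple_graph_def)
  ultimately have "finite (verts (coloring_complex X))" by (rule finite_subset)
  moreover have "card e = 2" if "e \<in> edges (coloring_complex X)" for e
    using that by (auto simp only: coloring_complex_def ugraph.simps mem_Collect_eq card_2_iff)
  ultimately show ?thesis by (auto simp: fin_simple_graph_def coloring_complex_def)
qed

end

theory Submission
  imports Defs
begin

text \<open>
  The classes of 3-colorings of \<open>L(\<Pi>\<^sub>n)\<close> are the perfect matchings of the prism. At each vertex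
  the two rails and the rung have distinct colors, so the two copies of the cycle either agree
  everywhere or disagree everywhere. In the first case the matching is given by an independent set
  \<open>S\<close> of cycle edges (used in both copies, completed by rungs); in the second it is one
  of two alternating matchings.

  Fix a 3-coloring of \<open>B(L(\<Pi>\<^sub>n))\<close> and let \<open>Q\<close> be the even or the odd edges of the cycle. The
  subsets of \<open>Q\<close> whose matching has the same color as the matching of \<open>Q\<close> form an ultrafilter:
  every partition of \<open>Q\<close> into three parts extends to a 3-coloring of the cycle edges. As \<open>Q\<close> is
  finite, the ultrafilter is principal, generated by some \<open>j\<close> for the even and some \<open>k\<close> for the
  odd side. If \<open>j\<close> and \<open>k\<close> were not adjacent, the matching of \<open>{j, k}\<close> would have two colors.
  So the coloring is the one induced by a vertex of the prism over the common endpoint of \<open>j\<close>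
  and \<open>k\<close>, and the colors of the two alternating matchings tell which of the two such vertices.
\<close>

section \<open>3-colorings, triangles and the canonical map in general graphs\<close>

definition exactly_one :: "bool \<Rightarrow> bool \<Rightarrow> bool \<Rightarrow> bool" where
  "exactly_one p q r \<longleftrightarrow> (p \<or> q \<or> r) \<and> \<not> (p \<and> q) \<and> \<not> (p \<and> r) \<and> \<not> (q \<and> r)"

definition triangle :: "'a ugraph \<Rightarrow> 'a \<Rightarrow> 'a \<Rightarrow> 'a \<Rightarrow> bool" where
  "triangle X x y z \<longleftrightarrow> {x, y, z} \<subseteq> verts X \<and> adj X x y \<and> adj X x z \<and> adj X y z"

lemma triangle_swap: "triangle X x y z \<Longrightarrow> triangle X y x z"
  and triangle_rotate: "triangle X x y z \<Longrightarrow> triangle X y z x"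
  by (auto simp: triangle_def adj_def insert_commute)

lemma three_coloringI:
  assumes "V1 \<union> V2 \<union> V3 = verts X" "V1 \<inter> V2 = {}" "V1 \<inter> V3 = {}" "V2 \<inter> V3 = {}"
    "independent X V1" "independent X V2" "independent X V3"
  shows "three_coloring X {V1, V2, V3}"
  unfolding three_coloring_def using assms by blast

lemma three_coloring_disjoint:
  assumes "three_coloring X P" "C \<in> P" "D \<in> P" "C \<noteq> D"
  shows "C \<inter> D = {}"
  using assms unfolding three_coloring_def by blast

text \<open>No class holds two of three pairwise adjacent vertices, so by pigeonhole the three
  vertices occupy the three parts, one each.\<close>

lemma three_coloring_triangle:
  assumes "three_coloring X P" "triangle X x y z" "W \<in> P"
  shows "exactly_one (x \<in> W) (y \<in> W) (z \<in> W)"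
proof -
  obtain V1 V2 V3 where P: "P = {V1, V2, V3}" and un: "V1 \<union> V2 \<union> V3 = verts X"
    and ind: "independent X V1" "independent X V2" "independent X V3"
    using assms(1) unfolding three_coloring_def by blast
  have "\<not> (a \<in> V \<and> b \<in> V)" if "V \<in> P" "adj X a b" for V a b
    using that ind unfolding P independent_def by blast
  then have no: "\<not> (x \<in> V \<and> y \<in> V) \<and> \<not> (x \<in> V \<and> z \<in> V) \<and> \<not> (y \<in> V \<and> z \<in> V)"
    if "V \<in> P" for V
    using that assms(2) unfolding triangle_def by blast
  have "x \<in> V1 \<union> V2 \<union> V3" "y \<in> V1 \<union> V2 \<union> V3" "z \<in> V1 \<union> V2 \<union> V3"
    using assms(2) un unfolding triangle_def by auto
  then show ?thesis
    using no[of V1] no[of V2] no[of V3] assms(3) unfolding P exactly_one_def by blast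
qed

lemma verts_coloring_complex:
  "C \<in> verts (coloring_complex X) \<longleftrightarrow> (\<exists>P. three_coloring X P \<and> C \<in> P)"
  by (simp add: coloring_complex_def)

lemma adj_coloring_complex:
  "adj (coloring_complex X) C D \<longleftrightarrow> C \<noteq> D \<and> (\<exists>P. three_coloring X P \<and> C \<in> P \<and> D \<in> P)"
  by (auto simp: adj_def coloring_complex_def doubleton_eq_iff)

lemma mem_canonical_map:
  "C \<in> canonical_map X v \<longleftrightarrow> C \<in> verts (coloring_complex X) \<and> v \<in> C"
  by (simp add: canonical_map_def)

text \<open>Each class meets the triangle in exactly one vertex, which gives the partition.
  Independence holds because distinct classes of a common coloring are disjoint, while all members
  of \<open>canonical_map X v\<close> contain \<open>v\<close>.\<close>

lemma three_coloring_canonical_map: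
  assumes "triangle X x y z"
  shows "three_coloring (coloring_complex X)
    {canonical_map X x, canonical_map X y, canonical_map X z}"
proof -
  have ex: "exactly_one (x \<in> C) (y \<in> C) (z \<in> C)" if "C \<in> verts (coloring_complex X)" for C
    using that three_coloring_triangle[OF _ assms] by (auto simp: verts_coloring_complex)
  have "independent (coloring_complex X) (canonical_map X v)" for v
    unfolding independent_def
  proof (intro conjI ballI)
    show "canonical_map X v \<subseteq> verts (coloring_complex X)"
      by (auto simp: mem_canonical_map)
    fix C D assume "C \<in> canonical_map X v" "D \<in> canonical_map X v"
    then show "\<not> adj (coloring_complex X) C D"
      using three_coloring_disjoint[of X _ C D] by (auto simp: mem_canonical_map adj_coloring_complex)
  qed
  moreover have "canonical_map X x \<union> canonical_map X y \<union> canonical_map X z =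
      verts (coloring_complex X)"
    "canonical_map X x \<inter> canonical_map X y = {}" "canonical_map X x \<inter> canonical_map X z = {}"
    "canonical_map X y \<inter> canonical_map X z = {}"
    using ex unfolding exactly_one_def set_eq_iff Un_iff Int_iff mem_canonical_map by blast+
  ultimately show ?thesis by (intro three_coloringI)
qed

text \<open>Reduces reflexivity to showing that all 3-colorings of the complex come from triangles.
  If the images of \<open>x\<close> and \<open>y\<close> are adjacent, they belong to the coloring
  of some triangle; by injectivity \<open>x\<close> and \<open>y\<close> are themselves vertices of
  that triangle, hence adjacent.\<close>

lemma reflexive_graphI:
  assumes "three_colorable X"
    and "no_isolated X"
    and edge_triangle: "\<And>x y. adj X x y \<Longrightarrow> \<exists>z. triangle X x y z"
    and inj: "inj_on (canonical_map X) (verts X)"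
    and onto: "\<And>P. three_coloring (coloring_complex X) P \<Longrightarrow>
      \<exists>x y z. triangle X x y z \<and> P = {canonical_map X x, canonical_map X y, canonical_map X z}"
  shows "reflexive_graph X"
proof -
  let ?\<phi> = "canonical_map X"
  let ?B = "coloring_complex (coloring_complex X)"
  have "?\<phi> x \<in> verts ?B" if x: "x \<in> verts X" for x
  proof -
    obtain y where "adj X x y" using x assms(2) by (auto simp: no_isolated_def)
    then obtain z where "triangle X x y z" using edge_triangle by blast
    then have "three_coloring (coloring_complex X) {?\<phi> x, ?\<phi> y, ?\<phi> z}"
      by (rule three_coloring_canonical_map)
    then show ?thesis by (auto simp: verts_coloring_complex)
  qed
  moreover have "C \<in> ?\<phi> ` verts X" if C: "C \<in> verts ?B" for C
  proof -
    obtain P where "three_coloring (coloring_complex X) P" "C \<in> P"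
      using C unfolding verts_coloring_complex by blast
    then show ?thesis using onto[of P] unfolding triangle_def by blast
  qed
  ultimately have "bij_betw ?\<phi> (verts X) (verts ?B)"
    using inj unfolding bij_betw_def by blast
  moreover have "adj X x y \<longleftrightarrow> adj ?B (?\<phi> x) (?\<phi> y)" if xy: "x \<in> verts X" "y \<in> verts X" for x y
  proof
    assume a: "adj X x y"
    then obtain z where tri: "triangle X x y z" using edge_triangle by blast
    obtain P where P: "three_coloring X P" using assms(1) unfolding three_colorable_def by blast
    have "x \<noteq> y"
      using P a xy(1) unfolding three_coloring_def independent_def by blast
    then have "?\<phi> x \<noteq> ?\<phi> y" using inj xy unfolding inj_on_def by blast
    then show "adj ?B (?\<phi> x) (?\<phi> y)"
      using three_coloring_canonical_map[OF tri] unfolding adj_coloring_complex by blast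
  next
    assume "adj ?B (?\<phi> x) (?\<phi> y)"
    then obtain P where ne: "?\<phi> x \<noteq> ?\<phi> y" and P: "three_coloring (coloring_complex X) P"
      "?\<phi> x \<in> P" "?\<phi> y \<in> P"
      unfolding adj_coloring_complex by blast
    obtain a b c where tri: "triangle X a b c" and Peq: "P = {?\<phi> a, ?\<phi> b, ?\<phi> c}"
      using onto[OF P(1)] by blast
    have "\<exists>v\<in>{a, b, c}. ?\<phi> x = ?\<phi> v" "\<exists>v\<in>{a, b, c}. ?\<phi> y = ?\<phi> v"
      using P(2,3) Peq by blast+
    then have "x \<in> {a, b, c}" "y \<in> {a, b, c}"
      using tri xy inj unfolding triangle_def inj_on_def by blast+
    moreover have "x \<noteq> y" using ne by blast
    ultimately show "adj X x y"
      using tri unfolding triangle_def adj_def by (auto simp: insert_commute)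
  qed
  ultimately show ?thesis
    using assms(1,2) unfolding reflexive_graph_def graph_iso_def by blast
qed

text \<open>Adjacency in the complex requires distinct classes. The triangle in \<open>X\<close>
  meets every part, so the parts are nonempty, and disjoint nonempty sets differ.\<close>

lemma coloring_complex_triangle:
  assumes tri: "triangle X x y z"
    and V: "V1 \<union> V2 \<union> V3 = verts X" "V1 \<inter> V2 = {}" "V1 \<inter> V3 = {}" "V2 \<inter> V3 = {}"
      "independent X V1" "independent X V2" "independent X V3"
  shows "triangle (coloring_complex X) V1 V2 V3"
proof -
  have P: "three_coloring X {V1, V2, V3}" using V by (rule three_coloringI)
  have "V \<noteq> {}" if "V \<in> {V1, V2, V3}" for V
    using three_coloring_triangle[OF P tri that] unfolding exactly_one_def by blast
  then have "V1 \<noteq> V2" "V1 \<noteq> V3" "V2 \<noteq> V3" using V(2-4) by auto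
  then show ?thesis
    unfolding triangle_def adj_coloring_complex using P
    by (auto simp: verts_coloring_complex)
qed

text \<open>\<open>\<mu>\<close> behaves like membership in an ultrafilter: it is additive on
  disjoint sets, so finiteness lets it descend from \<open>Q\<close> to a single point.\<close>

lemma principal_of_exactly_one:
  assumes "finite Q" "\<mu> Q"
    and part: "\<And>X Y Z. X \<union> Y \<union> Z = Q \<Longrightarrow> X \<inter> Y = {} \<Longrightarrow> X \<inter> Z = {} \<Longrightarrow> Y \<inter> Z = {} \<Longrightarrow>
      exactly_one (\<mu> X) (\<mu> Y) (\<mu> Z)"
  shows "\<exists>j\<in>Q. \<forall>X\<subseteq>Q. \<mu> X \<longleftrightarrow> j \<in> X"
proof -
  have empty: "\<not> \<mu> {}"
    using part[of Q "{}" "{}"] unfolding exactly_one_def by simp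
  \<comment> \<open>Two partitions of \<open>Q\<close> are compared that share the part
    \<open>Q - (X \<union> Y)\<close>: one has \<open>X\<close> and \<open>Y\<close> separate, the
    other has them merged, with an empty part.\<close>
  have add: "\<mu> (X \<union> Y) \<longleftrightarrow> \<mu> X \<or> \<mu> Y" "\<not> (\<mu> X \<and> \<mu> Y)"
    if "X \<subseteq> Q" "Y \<subseteq> Q" "X \<inter> Y = {}" for X Y
  proof -
    have "exactly_one (\<mu> X) (\<mu> Y) (\<mu> (Q - (X \<union> Y)))"
      using that by (intro part) auto
    moreover have "exactly_one (\<mu> (X \<union> Y)) (\<mu> {}) (\<mu> (Q - (X \<union> Y)))"
      using that by (intro part) auto
    ultimately show "\<mu> (X \<union> Y) \<longleftrightarrow> \<mu> X \<or> \<mu> Y" "\<not> (\<mu> X \<and> \<mu> Y)"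
      using empty unfolding exactly_one_def by blast+
  qed
  have "\<exists>j\<in>X. \<mu> {j}" if "finite X" "X \<subseteq> Q" "\<mu> X" for X
    using that
  proof (induction X rule: finite_induct)
    case empty
    then show ?case using \<open>\<not> \<mu> {}\<close> by blast
  next
    case (insert x X)
    then show ?case using add(1)[of "{x}" X] by auto
  qed
  then obtain j where j: "j \<in> Q" "\<mu> {j}" using assms(1,2) by blast
  have "\<mu> X \<longleftrightarrow> j \<in> X" if "X \<subseteq> Q" for X
  proof (cases "j \<in> X")
    case True
    have "{j} \<union> (X - {j}) = X" using True by auto
    then show ?thesis using add(1)[of "{j}" "X - {j}"] True j that by auto
  next
    case False
    then show ?thesis using add(2)[of "{j}" X] j that by auto
  qed
  then show ?thesis using j(1) by blast
qed

section \<open>The edges of the prism and the triangles of its line graph\<close>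

locale even_prism =
  fixes n :: nat
  assumes even_n: "even n" and n_ge: "n \<ge> 4"
begin

definition sc :: "nat \<Rightarrow> nat" where
  "sc i = (i + 1) mod n"

definition rail :: "nat \<Rightarrow> nat \<Rightarrow> (nat \<times> nat) set" where
  "rail l i = {(i, l), (sc i, l)}"

text \<open>The rungs are indexed so that \<open>rung i\<close> meets \<open>rail l i\<close> and \<open>rail l (sc i)\<close>.\<close>

definition rung :: "nat \<Rightarrow> (nat \<times> nat) set" where
  "rung i = {(sc i, 0), (sc i, 1)}"

abbreviation X :: "(nat \<times> nat) set ugraph" where
  "X \<equiv> line_graph (prism n)"

lemma sc_less [simp]: "sc i < n"
  using n_ge by (simp add: sc_def)

lemma sc_cases: "i < n \<Longrightarrow> sc i = (if i = n - 1 then 0 else i + 1)"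
  using n_ge by (auto simp: sc_def)

lemma sc_inject: "i < n \<Longrightarrow> j < n \<Longrightarrow> sc i = sc j \<longleftrightarrow> i = j"
  by (auto simp: sc_cases split: if_splits)

lemma sc_surj: "i < n \<Longrightarrow> \<exists>j<n. i = sc j"
  using n_ge by (intro exI[of _ "if i = 0 then n - 1 else i - 1"]) (auto simp: sc_cases)

lemma sc_neq: "i < n \<Longrightarrow> sc i \<noteq> i"
  using n_ge by (auto simp: sc_cases)

lemma sc_sc_neq: "i < n \<Longrightarrow> sc (sc i) \<noteq> i"
  using n_ge by (auto simp: sc_cases split: if_splits)

lemma even_sc: "i < n \<Longrightarrow> even (sc i) \<longleftrightarrow> odd i"
  using n_ge even_n by (auto simp: sc_cases)

lemma sc_induct:
  assumes "\<And>i. i < n \<Longrightarrow> D i \<longleftrightarrow> D (sc i)" "i < n" "j < n"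
  shows "D i \<longleftrightarrow> D j"
proof -
  have "D k \<longleftrightarrow> D 0" if "k < n" for k
    using that
  proof (induction k)
    case (Suc k)
    then have "sc k = Suc k" by (simp add: sc_def)
    then show ?case using assms(1)[of k] Suc by simp
  qed simp
  then show ?thesis using assms(2,3) by blast
qed

lemma rail_inject [simp]: "i < n \<Longrightarrow> j < n \<Longrightarrow> rail l i = rail k j \<longleftrightarrow> l = k \<and> i = j"
  using sc_sc_neq[of i] sc_neq[of i] by (auto simp: rail_def doubleton_eq_iff)

lemma rung_inject [simp]: "i < n \<Longrightarrow> j < n \<Longrightarrow> rung i = rung j \<longleftrightarrow> i = j"
  using sc_inject by (auto simp: rung_def doubleton_eq_iff)

lemma rail_neq_rung [simp]: "rail l i \<noteq> rung j" "rung j \<noteq> rail l i"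
  by (auto simp: rail_def rung_def doubleton_eq_iff)

lemma edges_prism: "edges (prism n) = {rail l i | l i. l < 2 \<and> i < n} \<union> {rung i | i. i < n}"
proof -
  have adj_cycle: "adj (cycle_graph n) a b \<longleftrightarrow> (a < n \<and> b = sc a) \<or> (b < n \<and> a = sc b)" for a b
    by (auto simp: adj_def cycle_graph_def doubleton_eq_iff sc_def)
  have adj_K2: "adj (complete_graph 2) a b \<longleftrightarrow> a < 2 \<and> b < 2 \<and> a \<noteq> b" for a b
    by (auto simp: adj_def complete_graph_def doubleton_eq_iff)
  have V: "verts (cycle_graph n) = {..<n}" "verts (complete_graph 2) = {..<2}"
    by (simp_all add: cycle_graph_def complete_graph_def)
  have E: "edges (prism n) = {{(a, b), (a', b')} | a b a' b'. a < n \<and> a' < n \<and> b < 2 \<and> b' < 2 \<and>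
      (a = a' \<and> b \<noteq> b' \<or> b = b' \<and> (a' = sc a \<or> a = sc a'))}"
    unfolding prism_def cartesian_product_def ugraph.simps
    by (intro Collect_cong ex_cong1)
      (auto simp: adj_cycle adj_K2 V)
  show ?thesis
  proof (intro equalityI subsetI)
    fix e assume "e \<in> edges (prism n)"
    then obtain a b a' b' where e: "e = {(a, b), (a', b')}" and ab: "a < n" "a' < n" "b < 2" "b' < 2"
      and c: "a = a' \<and> b \<noteq> b' \<or> b = b' \<and> (a' = sc a \<or> a = sc a')"
      unfolding E by blast
    from c consider "a = a'" "b \<noteq> b'" | "b = b'" "a' = sc a" | "b = b'" "a = sc a'" by blast
    then show "e \<in> {rail l i | l i. l < 2 \<and> i < n} \<union> {rung i | i. i < n}"
    proof cases
      case 1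
      then have "e = {(a, 0), (a, 1)}" using ab e by (auto simp: less_2_cases_iff)
      \<comment> \<open>The rung over the vertex \<open>a\<close> carries the index of the
        predecessor of \<open>a\<close> on the cycle.\<close>
      then show ?thesis using sc_surj[OF ab(1)] by (auto simp: rung_def)
    next
      case 2
      then have "e = rail b a" using e by (simp add: rail_def)
      then show ?thesis using ab by blast
    next
      case 3
      then have "e = rail b a'" using e by (auto simp: rail_def)
      then show ?thesis using ab by blast
    qed
  next
    fix e assume "e \<in> {rail l i | l i. l < 2 \<and> i < n} \<union> {rung i | i. i < n}"
    then consider l i where "e = rail l i" "l < 2" "i < n" | i where "e = rung i" "i < n" by blast
    then show "e \<in> edges (prism n)"
    proof cases
      case 1
      then show ?thesis unfolding E rail_def using sc_less by blast
    next
      case 2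
      moreover have "(0::nat) < 2" "(1::nat) < 2" "(0::nat) \<noteq> 1" by simp_all
      ultimately show ?thesis unfolding E rung_def using sc_less by blast
    qed
  qed
qed

lemma verts_X: "verts X = {rail l i | l i. l < 2 \<and> i < n} \<union> {rung i | i. i < n}"
  by (simp add: line_graph_def edges_prism)

lemma rail_in_X [simp]: "l < 2 \<Longrightarrow> i < n \<Longrightarrow> rail l i \<in> verts X"
  and rung_in_X [simp]: "i < n \<Longrightarrow> rung i \<in> verts X"
  by (auto simp: verts_X)

lemma verts_X_cases:
  assumes "e \<in> verts X"
  obtains (rail) l i where "e = rail l i" "l < 2" "i < n" | (rung) i where "e = rung i" "i < n"
  using assms by (auto simp: verts_X)

lemma adj_X: "adj X e f \<longleftrightarrow> e \<in> verts X \<and> f \<in> verts X \<and> e \<noteq> f \<and> e \<inter> f \<noteq> {}"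
  by (auto simp: adj_def line_graph_def doubleton_eq_iff)

text \<open>The prism is cubic; the three edges listed are the ones that \<open>triangle_X\<close>
  shows to form a triangle.\<close>

lemma incident_edges:
  assumes "e \<in> verts X" "(sc i, l) \<in> e" "i < n"
  shows "e \<in> {rail l i, rail l (sc i), rung i}"
  using assms(1)
proof (cases rule: verts_X_cases)
  case (rail k j)
  then show ?thesis using assms sc_inject by (auto simp: rail_def)
next
  case (rung j)
  then show ?thesis using assms sc_inject by (auto simp: rung_def)
qed

lemma vertex_cases:
  assumes "e \<in> verts X" "v \<in> e"
  obtains i l where "v = (sc i, l)" "i < n" "l < 2"
  using assms(1)
proof (cases rule: verts_X_cases)
  case (rail k j)
  then have "snd v < 2" "fst v < n" using assms(2) by (auto simp: rail_def)
  then show ?thesis using sc_surj that by (metis prod.collapse)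
next
  case (rung j)
  then have "snd v < 2" "fst v < n" using assms(2) by (auto simp: rung_def)
  then show ?thesis using sc_surj that by (metis prod.collapse)
qed

lemma triangle_X:
  assumes "i < n" "l < 2"
  shows "triangle X (rail l i) (rail l (sc i)) (rung i)"
  using assms sc_neq[of i]
  by (auto simp: triangle_def adj_X) (auto simp: rail_def rung_def less_2_cases_iff)

lemma adj_X_triangle:
  assumes "adj X e f"
  shows "\<exists>g. triangle X e f g"
proof -
  obtain v where v: "v \<in> e" "v \<in> f" and ef: "e \<in> verts X" "f \<in> verts X" "e \<noteq> f"
    using assms by (auto simp: adj_X)
  obtain i l where i: "v = (sc i, l)" "i < n" "l < 2" using vertex_cases[OF ef(1) v(1)] .
  have "e \<in> {rail l i, rail l (sc i), rung i}" "f \<in> {rail l i, rail l (sc i), rung i}"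
    using incident_edges i ef v by blast+
  moreover note tri = triangle_X[OF i(2,3)]
  \<comment> \<open>All six orderings of the triangle, since \<open>e\<close> and \<open>f\<close>
    may be any two of its vertices.\<close>
  note tri tri[THEN triangle_rotate] tri[THEN triangle_rotate, THEN triangle_rotate]
    tri[THEN triangle_swap] tri[THEN triangle_rotate, THEN triangle_swap]
    tri[THEN triangle_rotate, THEN triangle_rotate, THEN triangle_swap]
  ultimately show ?thesis
    using ef(3) by blast
qed

text \<open>The second assumption says that \<open>M\<close> is a perfect matching; two adjacent
  members would be two edges of \<open>M\<close> at a common end \<open>(sc i, l)\<close>.\<close>

lemma independent_X:
  assumes "M \<subseteq> verts X"
    and "\<And>i l. i < n \<Longrightarrow> l < 2 \<Longrightarrow> exactly_one (rail l i \<in> M) (rail l (sc i) \<in> M) (rung i \<in> M)"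
  shows "independent X M"
  unfolding independent_def
proof (intro conjI ballI notI)
  fix e f assume ef: "e \<in> M" "f \<in> M" "adj X e f"
  then obtain v where v: "v \<in> e" "v \<in> f" "e \<noteq> f" and E: "e \<in> verts X" "f \<in> verts X"
    by (auto simp: adj_X)
  obtain i l where i: "v = (sc i, l)" "i < n" "l < 2" using vertex_cases[OF E(1) v(1)] .
  have "e \<in> {rail l i, rail l (sc i), rung i}" "f \<in> {rail l i, rail l (sc i), rung i}"
    using incident_edges i E v by blast+
  then show False
    using assms(2)[OF i(2,3)] ef v(3) unfolding exactly_one_def by blast
qed (rule assms(1))

section \<open>Perfect matchings of the prism as color classes\<close>

definition indep :: "nat set \<Rightarrow> bool" where
  "indep S \<longleftrightarrow> S \<subseteq> {..<n} \<and> (\<forall>i\<in>S. sc i \<notin> S)"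

text \<open>Indices stand for cycle edges, with \<open>i\<close> and \<open>sc i\<close> adjacent at
  the vertex \<open>sc i\<close>. The rungs are those over vertices that no cycle edge in
  \<open>S\<close> covers.\<close>

definition mclass :: "nat set \<Rightarrow> (nat \<times> nat) set set" where
  "mclass S = {rail l i | l i. l < 2 \<and> i \<in> S} \<union> {rung i | i. i < n \<and> i \<notin> S \<and> sc i \<notin> S}"

text \<open>The values 0 and 1 of \<open>k\<close> give the two alternating matchings; any larger
  \<open>k\<close> gives the odd rails of both copies.\<close>

definition zigzag :: "nat \<Rightarrow> (nat \<times> nat) set set" where
  "zigzag k = {rail l i | l i. l < 2 \<and> i < n \<and> (l = k \<longleftrightarrow> even i)}"

lemma rail_mclass [simp]:
  "indep S \<Longrightarrow> l < 2 \<Longrightarrow> i < n \<Longrightarrow> rail l i \<in> mclass S \<longleftrightarrow> i \<in> S"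
  by (auto simp: mclass_def indep_def subset_iff)

lemma rung_mclass [simp]:
  "indep S \<Longrightarrow> i < n \<Longrightarrow> rung i \<in> mclass S \<longleftrightarrow> i \<notin> S \<and> sc i \<notin> S"
  by (auto simp: mclass_def)

lemma rail_zigzag [simp]:
  "l < 2 \<Longrightarrow> i < n \<Longrightarrow> rail l i \<in> zigzag k \<longleftrightarrow> (l = k \<longleftrightarrow> even i)"
  by (auto simp: zigzag_def)

lemma rung_zigzag [simp]: "rung i \<notin> zigzag k"
  by (auto simp: zigzag_def)

lemma mclass_subset: "indep S \<Longrightarrow> mclass S \<subseteq> verts X"
  by (auto simp: mclass_def indep_def verts_X)

lemma zigzag_subset: "zigzag k \<subseteq> verts X"
  by (auto simp: zigzag_def verts_X)

lemma independent_mclass: "indep S \<Longrightarrow> independent X (mclass S)"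
  by (rule independent_X[OF mclass_subset]) (auto simp: exactly_one_def indep_def)

text \<open>The parity of \<open>n\<close> enters through \<open>even_sc\<close>: parity alternates
  also where the cycle closes up.\<close>

lemma independent_zigzag: "independent X (zigzag k)"
  by (rule independent_X[OF zigzag_subset]) (auto simp: exactly_one_def even_sc)

lemma set_eq_X:
  assumes "M \<subseteq> verts X" "N \<subseteq> verts X"
    and "\<And>l i. l < 2 \<Longrightarrow> i < n \<Longrightarrow> rail l i \<in> M \<longleftrightarrow> rail l i \<in> N"
    and "\<And>i. i < n \<Longrightarrow> rung i \<in> M \<longleftrightarrow> rung i \<in> N"
  shows "M = N"
proof -
  have "e \<in> M \<longleftrightarrow> e \<in> N" if "e \<in> verts X" for e
    using that by (cases rule: verts_X_cases) (auto simp: assms(3,4))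
  then show ?thesis using assms(1,2) by blast
qed

definition partition3 :: "nat set \<Rightarrow> nat set \<Rightarrow> nat set \<Rightarrow> bool" where
  "partition3 S T U \<longleftrightarrow> indep S \<and> indep T \<and> indep U \<and> S \<union> T \<union> U = {..<n} \<and>
     S \<inter> T = {} \<and> S \<inter> U = {} \<and> T \<inter> U = {}"

text \<open>A common rung \<open>rung j\<close> would force both \<open>j\<close> and
  \<open>sc j\<close> into \<open>U\<close>, against its independence.\<close>

lemma mclass_disjoint:
  assumes "partition3 S T U"
  shows "mclass S \<inter> mclass T = {}"
proof -
  have i: "indep S" "indep T" "indep U" "S \<inter> T = {}" "S \<union> T \<union> U = {..<n}"
    using assms by (auto simp: partition3_def)
  have "e \<notin> mclass S \<inter> mclass T" if "e \<in> verts X" for e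
    using that
  proof (cases rule: verts_X_cases)
    case (rail l j)
    then show ?thesis using i by auto
  next
    case (rung j)
    moreover have "j \<in> S \<union> T \<union> U" "sc j \<in> S \<union> T \<union> U" using i(5) rung by auto
    moreover have "j \<in> U \<Longrightarrow> sc j \<notin> U" using i(3) by (auto simp: indep_def)
    ultimately show ?thesis using i(1,2) by auto
  qed
  then show ?thesis using mclass_subset[OF i(1)] by blast
qed

lemma partition3_perm:
  "partition3 S T U \<Longrightarrow> partition3 S U T" "partition3 S T U \<Longrightarrow> partition3 T U S"
  by (auto simp: partition3_def)

text \<open>\<open>j\<close> and \<open>sc j\<close> lie in two different parts, and
  \<open>rung j\<close> belongs to the matching of the third.\<close>

lemma mclass_Un:
  assumes "partition3 S T U"
  shows "mclass S \<union> mclass T \<union> mclass U = verts X"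
proof -
  have i: "indep S" "indep T" "indep U" "S \<inter> T = {}" "S \<inter> U = {}" "T \<inter> U = {}" "S \<union> T \<union> U = {..<n}"
    using assms by (auto simp: partition3_def)
  have "e \<in> mclass S \<union> mclass T \<union> mclass U" if "e \<in> verts X" for e
    using that
  proof (cases rule: verts_X_cases)
    case (rail l j)
    then show ?thesis using i by auto
  next
    case (rung j)
    then show ?thesis using i by (auto simp: indep_def)
  qed
  then show ?thesis using mclass_subset i(1-3) by blast
qed

lemma triangle_mclass:
  assumes "partition3 S T U"
  shows "triangle (coloring_complex X) (mclass S) (mclass T) (mclass U)"
proof (rule coloring_complex_triangle)
  show "triangle X (rail 0 0) (rail 0 (sc 0)) (rung 0)" using n_ge by (intro triangle_X) auto
  show "independent X (mclass S)" "independent X (mclass T)" "independent X (mclass U)"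
    using assms by (auto simp: partition3_def independent_mclass)
  show "mclass S \<union> mclass T \<union> mclass U = verts X" using assms by (rule mclass_Un)
  show "mclass S \<inter> mclass T = {}" "mclass S \<inter> mclass U = {}" "mclass T \<inter> mclass U = {}"
    using assms mclass_disjoint partition3_perm by blast+
qed

lemma indep_empty [simp]: "indep {}"
  by (simp add: indep_def)

text \<open>\<open>mclass {}\<close> consists of all rungs, and the two zigzags split the rails
  between them.\<close>

lemma triangle_zigzag:
  "triangle (coloring_complex X) (mclass {}) (zigzag 0) (zigzag 1)"
proof (rule coloring_complex_triangle)
  show "triangle X (rail 0 0) (rail 0 (sc 0)) (rung 0)" using n_ge by (intro triangle_X) auto
  show "independent X (mclass {})" by (simp add: independent_mclass)
  show "independent X (zigzag 0)" "independent X (zigzag 1)" by (rule independent_zigzag)+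
  have Z: "mclass {} \<subseteq> verts X" by (simp add: mclass_subset)
  show "mclass {} \<union> zigzag 0 \<union> zigzag 1 = verts X"
    by (rule set_eq_X) (use Z zigzag_subset in \<open>auto simp: less_2_cases_iff\<close>)
  show "mclass {} \<inter> zigzag 0 = {}" "mclass {} \<inter> zigzag 1 = {}" "zigzag 0 \<inter> zigzag 1 = {}"
    by (rule set_eq_X; use Z zigzag_subset in \<open>auto simp: less_2_cases_iff\<close>)+
qed

lemma class_cases:
  assumes "C \<in> verts (coloring_complex X)"
  obtains (mclass) S where "indep S" "C = mclass S" | (zigzag) k where "k < 2" "C = zigzag k"
proof -
  obtain P where P: "three_coloring X P" "C \<in> P"
    using assms by (auto simp: verts_coloring_complex)
  then have sub: "C \<subseteq> verts X" unfolding three_coloring_def by blast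
  have one: "exactly_one (rail l i \<in> C) (rail l (sc i) \<in> C) (rung i \<in> C)"
    if "i < n" "l < 2" for i l
    using three_coloring_triangle[OF P(1) triangle_X[OF that] P(2)] .
  define D where "D i \<longleftrightarrow> (rail 0 i \<in> C \<longleftrightarrow> rail 1 i \<in> C)" for i
  \<comment> \<open>\<open>rung i\<close> is common to both vertices over \<open>sc i\<close>. If it
    is in \<open>C\<close>, no rail at these vertices is; otherwise each copy has exactly one of its
    two rails there in \<open>C\<close>, so agreement of the copies carries over.\<close>
  have step: "D i \<longleftrightarrow> D (sc i)" if "i < n" for i
    using one[of i 0] one[of i 1] that unfolding D_def exactly_one_def by auto
  have D: "D i \<longleftrightarrow> D 0" if "i < n" for i
    using sc_induct[of D i 0, OF step that] n_ge by simp
  show thesis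
  proof (cases "D 0")
    case True
    define S where "S = {i. i < n \<and> rail 0 i \<in> C}"
    have S: "indep S"
      using one[of _ 0] unfolding indep_def S_def exactly_one_def by auto
    have "C = mclass S"
    proof (rule set_eq_X[OF sub mclass_subset[OF S]])
      fix l i :: nat assume "l < 2" "i < n"
      then show "rail l i \<in> C \<longleftrightarrow> rail l i \<in> mclass S"
        using D[of i] True S by (auto simp: D_def S_def less_2_cases_iff)
    next
      fix i assume "i < n"
      then show "rung i \<in> C \<longleftrightarrow> rung i \<in> mclass S"
        using one[of i 0] S by (auto simp: S_def exactly_one_def)
    qed
    then show ?thesis using S mclass by blast
  next
    case False
    \<comment> \<open>A rung in \<open>C\<close> would keep both rails over \<open>i\<close> out of
      \<open>C\<close>, so the copies would agree there.\<close>
    have nr: "rung i \<notin> C" if "i < n" for i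
      using one[of i 0] one[of i 1] D[OF that] False that unfolding D_def exactly_one_def by auto
    have alt: "(rail 0 i \<in> C \<longleftrightarrow> even i) \<longleftrightarrow> (rail 0 (sc i) \<in> C \<longleftrightarrow> even (sc i))" if "i < n" for i
      using one[of i 0] nr[OF that] even_sc[OF that] that unfolding exactly_one_def by auto
    have all: "(rail 0 i \<in> C \<longleftrightarrow> even i) \<longleftrightarrow> rail 0 0 \<in> C" if "i < n" for i
      using sc_induct[of "\<lambda>i. rail 0 i \<in> C \<longleftrightarrow> even i" i 0, OF alt that] n_ge by simp
    \<comment> \<open>\<open>rail 0 0\<close> belongs to \<open>zigzag k\<close> exactly for
      \<open>k = 0\<close>.\<close>
    define k :: nat where "k = (if rail 0 0 \<in> C then 0 else 1)"
    have "C = zigzag k"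
    proof (rule set_eq_X[OF sub zigzag_subset])
      fix l i :: nat assume "l < 2" "i < n"
      then show "rail l i \<in> C \<longleftrightarrow> rail l i \<in> zigzag k"
        using D[of i] all[of i] False by (auto simp: D_def k_def less_2_cases_iff)
    next
      fix i assume "i < n"
      then show "rung i \<in> C \<longleftrightarrow> rung i \<in> zigzag k" using nr by simp
    qed
    moreover have "k < 2" by (simp add: k_def)
    ultimately show ?thesis using zigzag by blast
  qed
qed

section \<open>The 3-colorings of the coloring complex\<close>

lemma indep_subset: "indep S \<Longrightarrow> T \<subseteq> S \<Longrightarrow> indep T"
  by (auto simp: indep_def)

text \<open>Every vertex outside \<open>Q\<close> has just two neighbours, which leave one of three colours free.\<close>

lemma extend_partition:
  assumes Q: "indep Q" "indep ({..<n} - Q)"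
    and XYZ: "X1 \<union> X2 \<union> X3 = Q" "X1 \<inter> X2 = {}" "X1 \<inter> X3 = {}" "X2 \<inter> X3 = {}"
  shows "\<exists>S T U. partition3 S T U \<and> S \<inter> Q = X1 \<and> T \<inter> Q = X2 \<and> U \<inter> Q = X3"
proof -
  define N where "N A = {y. y < n \<and> (sc y \<in> A \<or> (\<exists>x\<in>A. sc x = y))}" for A
  let ?R = "{..<n} - Q"
  \<comment> \<open>Greedy choice: each vertex outside \<open>Q\<close> joins the first part in
    which it has no neighbour.\<close>
  define Y1 where "Y1 = ?R - N X1"
  define Y2 where "Y2 = ?R \<inter> N X1 - N X2"
  define Y3 where "Y3 = ?R \<inter> N X1 \<inter> N X2"
  \<comment> \<open>Three neighbours in disjoint sets would be distinct, but \<open>y\<close> has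
    only \<open>sc y\<close> and its unique predecessor.\<close>
  have "y \<notin> N X3" if "y \<in> N X1" "y \<in> N X2" for y
    using that sc_inject XYZ Q(1) unfolding N_def indep_def
    by (smt (verit) UnI1 UnI2 disjoint_iff lessThan_iff mem_Collect_eq subset_iff)
  then have Y3: "Y3 \<inter> N X3 = {}" unfolding Y3_def by blast
  have ind: "indep (A \<union> B)" if "A \<subseteq> Q" "B \<subseteq> ?R" "B \<inter> N A = {}" for A B
    using that Q unfolding indep_def N_def by (auto simp: subset_iff disjoint_iff)
  have "partition3 (X1 \<union> Y1) (X2 \<union> Y2) (X3 \<union> Y3)"
    unfolding partition3_def
  proof (intro conjI)
    show "indep (X1 \<union> Y1)" by (rule ind) (use XYZ in \<open>auto simp: Y1_def\<close>)
    show "indep (X2 \<union> Y2)" by (rule ind) (use XYZ in \<open>auto simp: Y2_def\<close>)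
    show "indep (X3 \<union> Y3)" by (rule ind) (use XYZ Y3 in \<open>auto simp: Y3_def\<close>)
    have "Q \<subseteq> {..<n}" using Q(1) by (simp add: indep_def)
    then show "X1 \<union> Y1 \<union> (X2 \<union> Y2) \<union> (X3 \<union> Y3) = {..<n}"
      using XYZ(1) unfolding Y1_def Y2_def Y3_def by blast
    show "(X1 \<union> Y1) \<inter> (X2 \<union> Y2) = {}" "(X1 \<union> Y1) \<inter> (X3 \<union> Y3) = {}" "(X2 \<union> Y2) \<inter> (X3 \<union> Y3) = {}"
      using XYZ unfolding Y1_def Y2_def Y3_def by blast+
  qed
  moreover have "(X1 \<union> Y1) \<inter> Q = X1" "(X2 \<union> Y2) \<inter> Q = X2" "(X3 \<union> Y3) \<inter> Q = X3"
    using XYZ unfolding Y1_def Y2_def Y3_def by blast+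
  ultimately show ?thesis by blast
qed

text \<open>Membership of \<open>mclass S\<close> in \<open>W\<close> depends only on the trace of
  \<open>S\<close> on \<open>Q\<close>, and on subsets of \<open>Q\<close> it is principal by
  \<open>extend_partition\<close> and \<open>principal_of_exactly_one\<close>.\<close>

lemma color_class_of_side:
  assumes P: "three_coloring (coloring_complex X) P" "W \<in> P"
    and Q: "indep Q" "indep ({..<n} - Q)" and QW: "mclass Q \<in> W"
  shows "\<exists>j\<in>Q. \<forall>S. indep S \<longrightarrow> (mclass S \<in> W \<longleftrightarrow> j \<in> S)"
proof -
  let ?R = "{..<n} - Q"
  have Qn: "Q \<subseteq> {..<n}" using Q(1) by (simp add: indep_def)
  have tri: "exactly_one (mclass S \<in> W) (mclass T \<in> W) (mclass U \<in> W)" if "partition3 S T U" for S T U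
    using three_coloring_triangle[OF P(1) triangle_mclass[OF that] P(2)] .
  have R: "mclass Y \<notin> W" if "Y \<subseteq> ?R" for Y
  proof -
    have "partition3 Q Y (?R - Y)"
      using that Qn Q(1) indep_subset[OF Q(2) that] indep_subset[OF Q(2), of "?R - Y"]
      unfolding partition3_def by auto
    then show ?thesis using tri[of Q Y "?R - Y"] QW by (simp add: exactly_one_def)
  qed
  \<comment> \<open>The third part of the partition lies outside \<open>Q\<close>, so its matching
    is not in \<open>W\<close>; exactly one of the other two is.\<close>
  have compl: "mclass (Q - S) \<in> W \<longleftrightarrow> mclass S \<notin> W" if "indep S" for S
  proof -
    have "partition3 S (Q - S) (?R - S)"
      using that Qn indep_subset[OF Q(1), of "Q - S"] indep_subset[OF Q(2), of "?R - S"]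
      unfolding partition3_def by (auto simp: indep_def)
    then show ?thesis using tri[of S "Q - S" "?R - S"] R[of "?R - S"]
      unfolding exactly_one_def by blast
  qed
  \<comment> \<open>\<open>S\<close> and its trace on \<open>Q\<close> leave the same remainder in
    \<open>Q\<close>, so \<open>compl\<close> ties both to the same matching.\<close>
  have restrict: "mclass (S \<inter> Q) \<in> W \<longleftrightarrow> mclass S \<in> W" if "indep S" for S
  proof -
    have "Q - S \<inter> Q = Q - S" by blast
    then show ?thesis using compl[OF that] compl[of "S \<inter> Q"] indep_subset[OF that] by auto
  qed
  have "\<exists>j\<in>Q. \<forall>A\<subseteq>Q. mclass A \<in> W \<longleftrightarrow> j \<in> A"
  proof (rule principal_of_exactly_one)
    show "finite Q" using Qn finite_subset by blast
    show "mclass Q \<in> W" by (rule QW)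
    fix X1 X2 X3
    assume parts: "X1 \<union> X2 \<union> X3 = Q" "X1 \<inter> X2 = {}" "X1 \<inter> X3 = {}" "X2 \<inter> X3 = {}"
    obtain S T U where "partition3 S T U" "S \<inter> Q = X1" "T \<inter> Q = X2" "U \<inter> Q = X3"
      using extend_partition[OF Q parts] by blast
    then show "exactly_one (mclass X1 \<in> W) (mclass X2 \<in> W) (mclass X3 \<in> W)"
      using tri[of S T U] restrict unfolding partition3_def by auto
  qed
  then obtain j where "j \<in> Q" and j: "\<And>A. A \<subseteq> Q \<Longrightarrow> mclass A \<in> W \<longleftrightarrow> j \<in> A" by blast
  then have "mclass S \<in> W \<longleftrightarrow> j \<in> S" if "indep S" for S
    using restrict[OF that] j[of "S \<inter> Q"] by blast
  then show ?thesis using \<open>j \<in> Q\<close> by blast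
qed

lemma three_coloring_complex_X:
  assumes P: "three_coloring (coloring_complex X) P"
  shows "\<exists>x y z. triangle X x y z \<and> P = {canonical_map X x, canonical_map X y, canonical_map X z}"
proof -
  define E where "E = {i. i < n \<and> even i}"
  define O' where "O' = {i. i < n \<and> odd i}"
  have EO: "indep E" "indep O'" "{..<n} - E = O'" "{..<n} - O' = E"
    by (auto simp: E_def O'_def indep_def even_sc)
  have p: "partition3 E O' {}"
    using EO unfolding partition3_def by (auto simp: E_def O'_def)
  let ?Y = "coloring_complex X"
  obtain V1 V2 V3 where V: "P = {V1, V2, V3}" "V1 \<union> V2 \<union> V3 = verts ?Y"
    using P unfolding three_coloring_def by blast
  have cover: "\<exists>W\<in>P. C \<in> W" if "C \<in> verts ?Y" for C using V that by blast
  have tri: "exactly_one (mclass E \<in> W) (mclass O' \<in> W) (mclass {} \<in> W)" if "W \<in> P" for W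
    using three_coloring_triangle[OF P triangle_mclass[OF p] that] .
  have "mclass E \<in> verts ?Y" "mclass O' \<in> verts ?Y" "mclass {} \<in> verts ?Y"
    using triangle_mclass[OF p] by (auto simp: triangle_def)
  \<comment> \<open>The three classes are named after a triangle of the complex: the even rails, the
    odd rails and all rungs.\<close>
  then obtain W0 W1 W2 where W: "W0 \<in> P" "W1 \<in> P" "W2 \<in> P"
    and EW: "mclass E \<in> W0" and OW: "mclass O' \<in> W1" and RW: "mclass {} \<in> W2"
    using cover by metis
  have ne: "W0 \<noteq> W1" "W0 \<noteq> W2" "W1 \<noteq> W2"
    using tri[OF W(1)] tri[OF W(2)] EW OW RW unfolding exactly_one_def by blast+
  have "card P \<le> card {W0, W1, W2}" using ne by (simp add: V(1) card_insert_if)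
  then have Peq: "P = {W0, W1, W2}"
    using card_seteq[of P "{W0, W1, W2}"] W V(1) by auto
  have Wsub: "W \<subseteq> verts ?Y" if "W \<in> P" for W using V that by blast
  have disj: "W0 \<inter> W1 = {}" "W0 \<inter> W2 = {}" "W1 \<inter> W2 = {}"
    using three_coloring_disjoint[OF P] W ne by auto
  obtain j where j: "j \<in> E" "\<And>S. indep S \<Longrightarrow> mclass S \<in> W0 \<longleftrightarrow> j \<in> S"
    using color_class_of_side[OF P W(1) EO(1) _ EW] EO by auto
  obtain k where k: "k \<in> O'" "\<And>S. indep S \<Longrightarrow> mclass S \<in> W1 \<longleftrightarrow> k \<in> S"
    using color_class_of_side[OF P W(2) EO(2) _ OW] EO by auto
  have jk: "j < n" "k < n" "even j" "odd k" using j k by (auto simp: E_def O'_def)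
  have "\<not> indep {j, k}" using j(2)[of "{j, k}"] k(2)[of "{j, k}"] disj by auto
  then have "sc j = k \<or> sc k = j" using jk sc_neq by (auto simp: indep_def)
  \<comment> \<open>\<open>i\<close> is the one of \<open>j\<close> and \<open>k\<close> that
    precedes the other, so \<open>rung i\<close> sits at their common endpoint.\<close>
  then obtain i where i: "i < n" "(i = j \<and> sc i = k) \<or> (i = k \<and> sc i = j)" using jk by blast
  \<comment> \<open>As \<open>j\<close> is even, \<open>zigzag l\<close> is the alternating matching
    containing \<open>rail l j\<close>; so \<open>l\<close> must be the index of the zigzag in
    \<open>W0\<close>.\<close>
  define l :: nat where "l = (if zigzag 0 \<in> W0 then 0 else 1)"
  have l: "l < 2" by (simp add: l_def)
  have zz: "exactly_one (mclass {} \<in> W) (zigzag 0 \<in> W) (zigzag 1 \<in> W)" if "W \<in> P" for W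
    using three_coloring_triangle[OF P triangle_zigzag that] .
  have zz: "zigzag k' \<in> W0 \<longleftrightarrow> k' = l" "zigzag k' \<in> W1 \<longleftrightarrow> k' \<noteq> l" "zigzag k' \<notin> W2" if "k' < 2" for k'
  proof -
    have "mclass {} \<notin> W0" "mclass {} \<notin> W1" using RW disj by auto
    then have "zigzag 0 \<in> W0 \<longleftrightarrow> zigzag 1 \<notin> W0" "zigzag 0 \<in> W1 \<longleftrightarrow> zigzag 1 \<notin> W1"
      "zigzag 0 \<notin> W2" "zigzag 1 \<notin> W2"
      using zz[OF W(1)] zz[OF W(2)] zz[OF W(3)] RW unfolding exactly_one_def by blast+
    moreover have "\<not> (zigzag 0 \<in> W0 \<and> zigzag 0 \<in> W1)" "\<not> (zigzag 1 \<in> W0 \<and> zigzag 1 \<in> W1)"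
      using disj by blast+
    ultimately show "zigzag k' \<in> W0 \<longleftrightarrow> k' = l" "zigzag k' \<in> W1 \<longleftrightarrow> k' \<noteq> l" "zigzag k' \<notin> W2"
      using that unfolding l_def less_2_cases_iff by auto
  qed
  have mem: "(C \<in> W0 \<longleftrightarrow> rail l j \<in> C) \<and> (C \<in> W1 \<longleftrightarrow> rail l k \<in> C) \<and> (C \<in> W2 \<longleftrightarrow> rung i \<in> C)"
    if C: "C \<in> verts ?Y" for C
    using C
  proof (cases rule: class_cases)
    case (mclass S)
    \<comment> \<open>\<open>W2\<close> holds what \<open>W0\<close> and \<open>W1\<close> leave
      over, just as \<open>rung i\<close> is in \<open>mclass S\<close> when neither
      \<open>j\<close> nor \<open>k\<close> is in \<open>S\<close>.\<close>
    have "C \<in> W2 \<longleftrightarrow> C \<notin> W0 \<and> C \<notin> W1"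
      using cover[OF C] Peq disj by auto
    then show ?thesis using mclass j k jk l i by auto
  next
    case (zigzag k')
    then show ?thesis using zz[of k'] jk l by (auto simp: less_2_cases_iff)
  qed
  have "W0 = canonical_map X (rail l j)" "W1 = canonical_map X (rail l k)"
    "W2 = canonical_map X (rung i)"
    using mem Wsub[OF W(1)] Wsub[OF W(2)] Wsub[OF W(3)]
    unfolding set_eq_iff mem_canonical_map by blast+
  then have "P = {canonical_map X (rail l j), canonical_map X (rail l k), canonical_map X (rung i)}"
    using Peq by simp
  moreover have "triangle X (rail l j) (rail l k) (rung i)"
    using i(2) triangle_X[OF i(1) l] triangle_swap by auto
  ultimately show ?thesis by blast
qed

section \<open>Injectivity of the canonical map, and the conclusion\<close>

lemma indep_singleton: "i < n \<Longrightarrow> indep {i}"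
  using sc_neq by (auto simp: indep_def)

lemma mclass_in_complex:
  assumes "i < n"
  shows "mclass {i} \<in> verts (coloring_complex X)"
proof -
  \<comment> \<open>The parity class of \<open>i\<close>: removing \<open>i\<close> from it and
    adding the other parity class completes \<open>{i}\<close> to a partition into independent
    sets.\<close>
  define Q where "Q = {j. j < n \<and> (even j \<longleftrightarrow> even i)}"
  have Q: "indep Q" "indep ({..<n} - Q)" "i \<in> Q"
    using assms by (auto simp: Q_def indep_def even_sc)
  have "partition3 {i} (Q - {i}) ({..<n} - Q)"
    using Q indep_subset[OF Q(1)] unfolding partition3_def by (auto simp: Q_def)
  then show ?thesis using triangle_mclass unfolding triangle_def by blast
qed

text \<open>\<open>mclass {}\<close> separates rails from rungs, the matchings of single cycle edges
  determine the index, and \<open>zigzag 0\<close> separates the two copies.\<close>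

lemma inj_canonical_map_X: "inj_on (canonical_map X) (verts X)"
proof (rule inj_onI)
  fix e f assume ef: "e \<in> verts X" "f \<in> verts X" "canonical_map X e = canonical_map X f"
  then have sep: "e \<in> C \<longleftrightarrow> f \<in> C" if "C \<in> verts (coloring_complex X)" for C
    using that by (auto simp: mem_canonical_map set_eq_iff)
  have z: "zigzag 0 \<in> verts (coloring_complex X)" "mclass {} \<in> verts (coloring_complex X)"
    using triangle_zigzag by (auto simp: triangle_def)
  have m: "e \<in> mclass {i} \<longleftrightarrow> f \<in> mclass {i}" if "i < n" for i
    using sep mclass_in_complex that by blast
  show "e = f"
    using ef(1)
  proof (cases rule: verts_X_cases)
    case (rail l i)
    note e = this
    show ?thesis using ef(2)
    proof (cases rule: verts_X_cases)
      case (rail k j)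
      then show ?thesis
        using e m[of i] sep[OF z(1)] by (auto simp: indep_singleton less_2_cases_iff)
    next
      case (rung j)
      then show ?thesis using e sep[OF z(2)] by simp
    qed
  next
    case (rung i)
    note e = this
    show ?thesis using ef(2)
    proof (cases rule: verts_X_cases)
      case (rail k j)
      then show ?thesis using e sep[OF z(2)] by simp
    next
      case (rung j)
      \<comment> \<open>\<open>rung i\<close> is missed by the matchings of \<open>{i}\<close> and
        \<open>{sc i}\<close> only, so \<open>j\<close> and \<open>sc j\<close> are the same two
        indices; a swap would give \<open>sc (sc i) = i\<close>.\<close>
      then show ?thesis
        using e m[of i] m[of "sc i"] sc_sc_neq[of i] sc_neq[of i] sc_inject[of i j]
        by (auto simp: indep_singleton)
    qed
  qed
qed

lemma edge_reflexive_prism: "edge_reflexive (prism n)"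
proof -
  \<comment> \<open>An edge of the complex already presupposes a 3-coloring of
    \<open>X\<close>.\<close>
  have col: "three_colorable X"
    using triangle_zigzag unfolding three_colorable_def triangle_def adj_coloring_complex by blast
  moreover have "no_isolated X"
    unfolding no_isolated_def
  proof
    fix e assume e: "e \<in> verts X"
    then show "\<exists>f\<in>verts X. adj X e f"
    proof (cases rule: verts_X_cases)
      case (rail l i)
      then show ?thesis using triangle_X[of i l] unfolding triangle_def by blast
    next
      case (rung i)
      then show ?thesis using triangle_X[of i 0, THEN triangle_rotate, THEN triangle_rotate]
        unfolding triangle_def by auto
    qed
  qed
  ultimately have "reflexive_graph X"
    using adj_X_triangle inj_canonical_map_X three_coloring_complex_X by (rule reflexive_graphI)
  then show ?thesis using col by (simp add: edge_reflexive_def three_edge_colorable_def)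
qed

end

theorem theorem17:
  fixes n :: nat
  assumes "even n" and "n \<ge> 4"
  shows "edge_reflexive (prism n)"
proof -
  interpret even_prism n using assms by unfold_locales
  show ?thesis by (rule edge_reflexive_prism)
qed

end
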